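(* Let $\mathcal{A}$ be an independence algebra with universe $A$ and let $\mathcal{B}$ be a non-empty subalgebra of $\mathcal{A}$ with universe $B$. Assume $\mathcal{B}\neq\mathcal{A}$ and that either $\dim B\geq 2$, or $\langle\emptyset\rangle\neq\emptyset$ and $\dim B=1$. Let $T(\mathcal{A},\mathcal{B})$ be the semigroup of all endomorphisms of $\mathcal{A}$ whose image is contained in $B$. For $\alpha,\beta\in T(\mathcal{A},\mathcal{B})$ we have $\alpha\,\widetilde{\mathcal{L}}\,\beta$ in $T(\mathcal{A},\mathcal{B})$ if and only if $\mathrm{im}\,\alpha=\mathrm{im}\,\beta$. Thus $\mathcal{L}^*=\widetilde{\mathcal{L}}$ in $T(\mathcal{A},\mathcal{B})$.
   Context: An algebra $\mathcal{A}=\langle A;F\rangle$ has a non-empty universe $A$ and a set $F$ of finitary operations. For $X\subseteq A$, $\langle X\rangle$ is the set of all $t(a_1,\dots,a_n)$ with $t$ a term operation and $a_i\in X$ (the subalgebra generated by $X$); $\langle\emptyset\rangle$ is the set of constants, i.e. values of nullary term operations (possibly empty). $X$ is independent if $x\notin\langle X\setminus\{x\}\rangle$ for all $x\in X$; a basis of a subalgebra is an independent generating set. Exchange property (EP): for all $X\subseteq A$ and $a,b\in A$, if $b\in\langle X\cup\{a\}\rangle$ and $b\notin\langle X\rangle$ then $a\in\langle X\cup\{b\}\rangle$. Under (EP) every subalgebra has a basis, all its bases have the same cardinality (its dimension, $\dim$), and independent sets extend to bases. Free basis property (F): every map from a basis of $\mathcal{A}$ to $A$ extends to an endomorphism of $\mathcal{A}$.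 An independence algebra is an algebra satisfying (EP) and (F). Dimensions may be finite or infinite. Maps are written on the right and composed left to right. $\mathrm{im}\,\alpha=A\alpha$. For a semigroup $S$ with set of idempotents $E(S)$ and $a,b\in S$: $a\,\mathcal{L}^*\,b$ iff for all $x,y\in S^1$, $ax=ay\Leftrightarrow bx=by$; $a\,\widetilde{\mathcal{L}}\,b$ iff for all $f\in E(S)$, $af=a\Leftrightarrow bf=b$. *)

theory Defs
  imports Main "HOL-Library.FuncSet"
begin

unbundle cardinal_syntax

text \<open>
  An algebra is given by its universe \<^term>\<open>A :: 'a set\<close> and a set \<^term>\<open>F\<close> of pairs
  \<^term>\<open>(n, f)\<close>, where \<^term>\<open>f\<close> is an operation of arity \<^term>\<open>n\<close> (possibly \<open>0\<close>) taking its
  arguments as a list; only the values of \<^term>\<open>f\<close> on lists of length \<^term>\<open>n\<close> over \<^term>\<open>A\<close>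
  matter.
\<close>

type_synonym 'a operations = "(nat \<times> ('a list \<Rightarrow> 'a)) set"

definition closed_under :: "'a operations \<Rightarrow> 'a set \<Rightarrow> bool" where
  "closed_under F B \<longleftrightarrow>
     (\<forall>(n, f) \<in> F. \<forall>xs. length xs = n \<and> set xs \<subseteq> B \<longrightarrow> f xs \<in> B)"

definition is_algebra :: "'a set \<Rightarrow> 'a operations \<Rightarrow> bool" where
  "is_algebra A F \<longleftrightarrow> A \<noteq> {} \<and> closed_under F A"

text \<open>The empty set is a subalgebra exactly when there are no nullary operations.\<close>

definition subalgebra :: "'a set \<Rightarrow> 'a operations \<Rightarrow> 'a set \<Rightarrow> bool" where
  "subalgebra A F B \<longleftrightarrow> B \<subseteq> A \<and> closed_under F B"

inductive term_op :: "'a operations \<Rightarrow> nat \<Rightarrow> ('a list \<Rightarrow> 'a) \<Rightarrow> bool"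
  for F :: "'a operations" and n :: nat where
  proj: "i < n \<Longrightarrow> term_op F n (\<lambda>xs. xs ! i)"
| comp: "(k, f) \<in> F \<Longrightarrow> length ts = k \<Longrightarrow> (\<forall>t \<in> set ts. term_op F n t) \<Longrightarrow>
         term_op F n (\<lambda>xs. f (map (\<lambda>t. t xs) ts))"

text \<open>
  For \<^term>\<open>X = {}\<close> only \<^term>\<open>n = 0\<close> contributes, so \<open>gen F {}\<close> consists of the values of the
  nullary term operations.
\<close>

definition gen :: "'a operations \<Rightarrow> 'a set \<Rightarrow> 'a set" where
  "gen F X = {t xs | n t xs. term_op F n t \<and> length xs = n \<and> set xs \<subseteq> X}"

definition independent :: "'a operations \<Rightarrow> 'a set \<Rightarrow> bool" where
  "independent F X \<longleftrightarrow> (\<forall>x \<in> X. x \<notin> gen F (X - {x}))"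

definition basis_of :: "'a operations \<Rightarrow> 'a set \<Rightarrow> 'a set \<Rightarrow> bool" where
  "basis_of F B X \<longleftrightarrow> X \<subseteq> B \<and> independent F X \<and> gen F X = B"

text \<open>
  The dimension is a (possibly infinite) cardinal.  The exchange property makes it independent,
  up to \<open>=o\<close>, of the chosen basis.
\<close>

definition alg_dim :: "'a operations \<Rightarrow> 'a set \<Rightarrow> 'a rel" where
  "alg_dim F B = |SOME X. basis_of F B X|"

definition exchange_property :: "'a set \<Rightarrow> 'a operations \<Rightarrow> bool" where
  "exchange_property A F \<longleftrightarrow>
     (\<forall>X a b. X \<subseteq> A \<and> a \<in> A \<and> b \<in> A \<and> b \<in> gen F (X \<union> {a}) \<and> b \<notin> gen F X
        \<longrightarrow> a \<in> gen F (X \<union> {b}))"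

text \<open>
  Maps \<open>A \<rightarrow> A\<close> are represented by extensional functions, so that HOL equality is equality of
  maps on \<^term>\<open>A\<close>.
\<close>

definition endomorphisms :: "'a set \<Rightarrow> 'a operations \<Rightarrow> ('a \<Rightarrow> 'a) set" where
  "endomorphisms A F =
     {\<alpha> \<in> A \<rightarrow>\<^sub>E A. \<forall>(n, f) \<in> F. \<forall>xs. length xs = n \<and> set xs \<subseteq> A \<longrightarrow>
                       \<alpha> (f xs) = f (map \<alpha> xs)}"

definition free_basis_property :: "'a set \<Rightarrow> 'a operations \<Rightarrow> bool" where
  "free_basis_property A F \<longleftrightarrow>
     (\<forall>X g. basis_of F A X \<and> g \<in> X \<rightarrow> A \<longrightarrow>
        (\<exists>\<phi> \<in> endomorphisms A F. \<forall>x \<in> X. \<phi> x = g x))"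

definition independence_algebra :: "'a set \<Rightarrow> 'a operations \<Rightarrow> bool" where
  "independence_algebra A F \<longleftrightarrow>
     is_algebra A F \<and> exchange_property A F \<and> free_basis_property A F"

definition endos_into :: "'a set \<Rightarrow> 'a operations \<Rightarrow> 'a set \<Rightarrow> ('a \<Rightarrow> 'a) set" where
  "endos_into A F B = {\<alpha> \<in> endomorphisms A F. \<alpha> ` A \<subseteq> B}"

text \<open>Maps compose from left to right: \<open>rcomp A \<alpha> \<beta>\<close> applies \<open>\<alpha>\<close> first.\<close>

definition rcomp :: "'a set \<Rightarrow> ('a \<Rightarrow> 'a) \<Rightarrow> ('a \<Rightarrow> 'a) \<Rightarrow> ('a \<Rightarrow> 'a)" where
  "rcomp A \<alpha> \<beta> = compose A \<beta> \<alpha>"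

lemma rcomp_endos_into:
  assumes "B \<subseteq> A" "\<alpha> \<in> endos_into A F B" "\<beta> \<in> endos_into A F B" "is_algebra A F"
  shows "rcomp A \<alpha> \<beta> \<in> endos_into A F B"
proof -
  have a: "\<alpha> \<in> A \<rightarrow> A" "\<alpha> ` A \<subseteq> B" and b: "\<beta> \<in> A \<rightarrow> A" "\<beta> ` A \<subseteq> B"
    using assms(2,3) by (auto simp: endos_into_def endomorphisms_def)
  have "rcomp A \<alpha> \<beta> (f xs) = f (map (rcomp A \<alpha> \<beta>) xs)"
    if f: "(n, f) \<in> F" and xs: "length xs = n" "set xs \<subseteq> A" for n f xs
  proof -
    have "f xs \<in> A"
      using assms(4) f xs by (fastforce simp: is_algebra_def closed_under_def)
    moreover have "\<alpha> (f xs) = f (map \<alpha> xs)"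
      using assms(2) f xs by (fastforce simp: endos_into_def endomorphisms_def)
    moreover have "\<beta> (f (map \<alpha> xs)) = f (map \<beta> (map \<alpha> xs))"
    proof -
      have "length (map \<alpha> xs) = n" "set (map \<alpha> xs) \<subseteq> A" using xs a by auto
      then show ?thesis
        using assms(3) f unfolding endos_into_def endomorphisms_def by blast
    qed
    moreover have "map (rcomp A \<alpha> \<beta>) xs = map \<beta> (map \<alpha> xs)"
      using xs by (auto simp: rcomp_def compose_def)
    ultimately show ?thesis by (metis compose_eq rcomp_def)
  qed
  moreover have "rcomp A \<alpha> \<beta> \<in> A \<rightarrow>\<^sub>E A" "rcomp A \<alpha> \<beta> ` A \<subseteq> B"
    using a b assms(1) by (auto simp: rcomp_def compose_def image_subset_iff Pi_iff)
  ultimately show ?thesis by (auto simp: endos_into_def endomorphisms_def)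
qed

lemma rcomp_assoc:
  assumes "\<alpha> \<in> endomorphisms A F"
  shows "rcomp A (rcomp A \<alpha> \<beta>) \<gamma> = rcomp A \<alpha> (rcomp A \<beta> \<gamma>)"
  using assms by (auto simp: rcomp_def endomorphisms_def compose_def fun_eq_iff)

text \<open>
  A semigroup is given by a carrier \<^term>\<open>S\<close> and a multiplication \<^term>\<open>m\<close>.  In \<open>S\<^sup>1\<close> the
  element \<^term>\<open>None\<close> is the identity adjoined when \<^term>\<open>S\<close> has none of its own.
\<close>

definition has_identity :: "'s set \<Rightarrow> ('s \<Rightarrow> 's \<Rightarrow> 's) \<Rightarrow> bool" where
  "has_identity S m \<longleftrightarrow> (\<exists>e \<in> S. \<forall>x \<in> S. m e x = x \<and> m x e = x)"

definition adjoin_one :: "'s set \<Rightarrow> ('s \<Rightarrow> 's \<Rightarrow> 's) \<Rightarrow> 's option set" where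
  "adjoin_one S m = (if has_identity S m then Some ` S else insert None (Some ` S))"

fun mult_one :: "('s \<Rightarrow> 's \<Rightarrow> 's) \<Rightarrow> 's \<Rightarrow> 's option \<Rightarrow> 's" where
  "mult_one m a None = a"
| "mult_one m a (Some x) = m a x"

definition idempotents :: "'s set \<Rightarrow> ('s \<Rightarrow> 's \<Rightarrow> 's) \<Rightarrow> 's set" where
  "idempotents S m = {e \<in> S. m e e = e}"

definition L_star :: "'s set \<Rightarrow> ('s \<Rightarrow> 's \<Rightarrow> 's) \<Rightarrow> 's rel" where
  "L_star S m = {(a, b) \<in> S \<times> S. \<forall>x \<in> adjoin_one S m. \<forall>y \<in> adjoin_one S m.
     mult_one m a x = mult_one m a y \<longleftrightarrow> mult_one m b x = mult_one m b y}"

definition L_tilde :: "'s set \<Rightarrow> ('s \<Rightarrow> 's \<Rightarrow> 's) \<Rightarrow> 's rel" where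
  "L_tilde S m = {(a, b) \<in> S \<times> S. \<forall>f \<in> idempotents S m. m a f = a \<longleftrightarrow> m b f = b}"

end

(* For \<alpha> with image C, choose a basis of C and extend it to a basis of A.  Fixing the former and
   sending the rest to a single point of C gives an idempotent endomorphism of A whose image and
   fixed-point set are both C.  It is a right identity of \<alpha>, and of \<beta> exactly when the image of
   \<beta> lies in C, so \<alpha> and \<beta> are related by L-tilde only if their images coincide.  Conversely,
   an equation \<alpha> x = \<alpha> y over T(A,B) with an identity adjoined depends only on the image of \<alpha>. *)
theory Submission
  imports Defs
begin

section \<open>Term operations, generated subalgebras and endomorphisms\<close>

lemma closed_underD:
  assumes "closed_under F C" "(n, f) \<in> F" "length xs = n" "set xs \<subseteq> C"
  shows "f xs \<in> C"
  using assms unfolding closed_under_def by fast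

lemma endomorphismsD:
  assumes "\<phi> \<in> endomorphisms A F" "(n, f) \<in> F" "length xs = n" "set xs \<subseteq> A"
  shows "\<phi> (f xs) = f (map \<phi> xs)"
  using assms unfolding endomorphisms_def by fast

lemma term_op_closed:
  assumes "term_op F n t" "closed_under F C" "length xs = n" "set xs \<subseteq> C"
  shows "t xs \<in> C"
  using assms(1)
proof induction
  case (proj i)
  then show ?case using assms by auto
next
  case (comp k f ts)
  show ?case by (rule closed_underD[OF assms(2) comp(1)]) (use comp in auto)
qed

lemma term_op_endomorphism:
  assumes "term_op F n t" "\<phi> \<in> endomorphisms A F" "closed_under F A"
    and "length xs = n" "set xs \<subseteq> A"
  shows "\<phi> (t xs) = t (map \<phi> xs)"
  using assms(1)
proof induction
  case (proj i)
  then show ?case using assms by simp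
next
  case (comp k f ts)
  \<comment> \<open>The homomorphism condition only covers arguments in \<open>A\<close>;
    \<open>term_op_closed\<close> puts the values of the subterms there.\<close>
  have "\<phi> (f (map (\<lambda>t. t xs) ts)) = f (map \<phi> (map (\<lambda>t. t xs) ts))"
    by (rule endomorphismsD[OF assms(2) comp(1)])
      (use comp assms(3-5) term_op_closed in \<open>fastforce+\<close>)
  also have "map \<phi> (map (\<lambda>t. t xs) ts) = map (\<lambda>t. t (map \<phi> xs)) ts"
    using comp by simp
  finally show ?case .
qed

lemma gen_least:
  assumes "closed_under F C" "X \<subseteq> C"
  shows "gen F X \<subseteq> C"
  using assms term_op_closed unfolding gen_def by fastforce

lemma gen_mono: "X \<subseteq> Y \<Longrightarrow> gen F X \<subseteq> gen F Y"
  unfolding gen_def by blast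

lemma gen_superset: "X \<subseteq> gen F X"
proof
  fix x assume "x \<in> X"
  have "term_op F 1 (\<lambda>xs. xs ! 0)" by (rule term_op.proj) simp
  with \<open>x \<in> X\<close> show "x \<in> gen F X"
    unfolding gen_def by (intro CollectI exI[of _ 1] exI[of _ "\<lambda>xs. xs ! 0"] exI[of _ "[x]"]) auto
qed

text \<open>One value of a term operation uses one argument list, whose finitely many entries form
  \<open>Y\<close>.\<close>

lemma gen_finitary:
  assumes "x \<in> gen F X"
  obtains Y where "finite Y" "Y \<subseteq> X" "x \<in> gen F Y"
  using assms unfolding gen_def by fastforce

text \<open>Since \<open>\<phi>\<close> commutes with term operations, its values on generated
  elements are terms in its values on \<open>X\<close>.\<close>

lemma endomorphism_image_gen:
  assumes "\<phi> \<in> endomorphisms A F" "closed_under F A" "X \<subseteq> A" "closed_under F C" "\<phi> ` X \<subseteq> C"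
  shows "\<phi> ` gen F X \<subseteq> C"
proof
  fix y assume "y \<in> \<phi> ` gen F X"
  then obtain n t xs where t: "term_op F n t" "length xs = n" "set xs \<subseteq> X" "y = \<phi> (t xs)"
    unfolding gen_def by auto
  then have "y = t (map \<phi> xs)"
    using term_op_endomorphism assms(1-3) by fastforce
  also have "\<dots> \<in> C"
    by (rule term_op_closed[OF t(1) assms(4)]) (use t assms(5) in auto)
  finally show "y \<in> C" .
qed

lemma endomorphism_fixes_gen:
  assumes "\<phi> \<in> endomorphisms A F" "closed_under F A" "X \<subseteq> A" "\<And>x. x \<in> X \<Longrightarrow> \<phi> x = x"
    and "y \<in> gen F X"
  shows "\<phi> y = y"
proof -
  obtain n t xs where t: "term_op F n t" "length xs = n" "set xs \<subseteq> X" "y = t xs"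
    using assms(5) unfolding gen_def by auto
  then have "\<phi> y = t (map \<phi> xs)"
    using term_op_endomorphism assms(1-3) by fastforce
  moreover have "map \<phi> xs = xs" using t(3) assms(4) by (auto intro: map_idI)
  ultimately show ?thesis using t(4) by simp
qed

lemma closed_under_endomorphism_image:
  assumes "\<phi> \<in> endomorphisms A F" "closed_under F A"
  shows "closed_under F (\<phi> ` A)"
  unfolding closed_under_def
proof clarify
  fix n f ys assume f: "(length ys, f) \<in> F" and "set ys \<subseteq> \<phi> ` A"
  then have "ys \<in> lists (\<phi> ` A)" by auto
  then obtain xs where xs: "ys = map \<phi> xs" "set xs \<subseteq> A"
    unfolding lists_image by auto
  then have "\<phi> (f xs) = f ys" "f xs \<in> A"
    using endomorphismsD[OF assms(1) f] closed_underD[OF assms(2) f] by auto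
  then show "f ys \<in> \<phi> ` A" by force
qed

section \<open>Exchange and the existence of bases\<close>

lemma exchange_propertyD:
  assumes "exchange_property A F" "X \<subseteq> A" "a \<in> A" "b \<in> A"
    and "b \<in> gen F (X \<union> {a})" "b \<notin> gen F X"
  shows "a \<in> gen F (X \<union> {b})"
  using assms(1)[unfolded exchange_property_def, THEN spec[of _ X], THEN spec[of _ a], THEN spec[of _ b]]
    assms(2-6) by blast

text \<open>If some \<open>x\<close> in \<open>Y\<close> depended on \<open>a\<close> and the rest
  of \<open>Y\<close>, exchange would swap \<open>x\<close> with \<open>a\<close> and place
  \<open>a\<close> in \<open>gen F Y\<close>.\<close>

lemma independent_insert:
  assumes "exchange_property A F" "Y \<subseteq> A" "a \<in> A" "independent F Y" "a \<notin> gen F Y"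
  shows "independent F (insert a Y)"
  unfolding independent_def
proof
  fix x assume x: "x \<in> insert a Y"
  have a: "a \<notin> Y" using gen_superset[of Y F] assms(5) by blast
  show "x \<notin> gen F (insert a Y - {x})"
  proof (cases "x = a")
    case True
    then show ?thesis using a assms(5) by simp
  next
    case False
    then have xY: "x \<in> Y" using x by simp
    show ?thesis
    proof
      assume "x \<in> gen F (insert a Y - {x})"
      moreover have "insert a Y - {x} = (Y - {x}) \<union> {a}" using False by auto
      ultimately have x_gen: "x \<in> gen F ((Y - {x}) \<union> {a})" by (rule back_subst[of "\<lambda>Z. x \<in> gen F Z"])
      have "x \<notin> gen F (Y - {x})" using assms(4) xY by (simp add: independent_def)
      then have "a \<in> gen F ((Y - {x}) \<union> {x})"
        using exchange_propertyD[OF assms(1) _ assms(3) _ x_gen] assms(2) xY by blast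
      moreover have "(Y - {x}) \<union> {x} = Y" using xY by auto
      ultimately show False using assms(5) by simp
    qed
  qed
qed

text \<open>A dependence involves finitely many elements, so it already occurs inside one member of
  the chain.\<close>

lemma independent_Union_chain:
  assumes "subset.chain \<A> \<C>" "\<And>X. X \<in> \<C> \<Longrightarrow> independent F X"
  shows "independent F (\<Union>\<C>)"
  unfolding independent_def
proof (intro ballI notI)
  fix x assume x: "x \<in> \<Union>\<C>" and "x \<in> gen F (\<Union>\<C> - {x})"
  then obtain Y where Y: "finite Y" "Y \<subseteq> \<Union>\<C> - {x}" "x \<in> gen F Y"
    using gen_finitary by metis
  \<comment> \<open>The point \<open>x\<close> is kept together with \<open>Y\<close> so that a
    single member contains the whole dependence.\<close>
  have "finite (insert x Y)" "insert x Y \<subseteq> \<Union>\<C>" "\<C> \<noteq> {}" using x Y by auto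
  then obtain M where M: "M \<in> \<C>" "insert x Y \<subseteq> M"
    using finite_subset_Union_chain assms(1) by metis
  then have "x \<in> gen F (M - {x})" using Y gen_mono[of Y "M - {x}" F] by blast
  then show False using assms(2) M unfolding independent_def by blast
qed

text \<open>By Zorn there is a maximal independent set between \<open>X\<close> and
  \<open>C\<close>. It generates \<open>C\<close>, for otherwise \<open>independent_insert\<close>
  would enlarge it. Starting from the empty set, this gives a basis of \<open>C\<close>.\<close>

lemma independent_extends_to_basis:
  assumes "exchange_property A F" "C \<subseteq> A" "closed_under F C" "X \<subseteq> C" "independent F X"
  obtains Y where "X \<subseteq> Y" "basis_of F C Y"
proof -
  define \<A> where "\<A> = {Y. X \<subseteq> Y \<and> Y \<subseteq> C \<and> independent F Y}"
  have "\<A> \<noteq> {}" using assms unfolding \<A>_def by auto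
  moreover have "\<Union>\<C> \<in> \<A>" if "\<C> \<noteq> {}" "subset.chain \<A> \<C>" for \<C>
  proof -
    have "\<C> \<subseteq> \<A>" using that(2) by (simp add: subset_chain_def)
    then show ?thesis
      using that independent_Union_chain[OF that(2)] unfolding \<A>_def by blast
  qed
  ultimately have "\<exists>Y\<in>\<A>. \<forall>Z\<in>\<A>. Y \<subseteq> Z \<longrightarrow> Z = Y"
    by (rule subset_Zorn_nonempty)
  then obtain Y where "Y \<in> \<A>" and max: "\<And>Z. Z \<in> \<A> \<Longrightarrow> Y \<subseteq> Z \<Longrightarrow> Z = Y"
    by blast
  then have Y: "X \<subseteq> Y" "Y \<subseteq> C" "independent F Y" by (auto simp: \<A>_def)
  have "C \<subseteq> gen F Y"
  proof
    fix a assume a: "a \<in> C"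
    show "a \<in> gen F Y"
    proof (rule ccontr)
      assume na: "a \<notin> gen F Y"
      then have "independent F (insert a Y)"
        using independent_insert[OF assms(1) _ _ Y(3)] assms(2) Y(2) a by blast
      then have "insert a Y \<in> \<A>" using Y a by (auto simp: \<A>_def)
      then have "insert a Y = Y" using max by blast
      then show False using na gen_superset[of Y F] by blast
    qed
  qed
  then have "gen F Y = C" using gen_least[OF assms(3) Y(2)] by blast
  with Y that show ?thesis by (auto simp: basis_of_def)
qed

text \<open>The map prescribed on a basis is controlled everywhere by generation: \<open>Z\<close>
  generates \<open>A\<close> and is sent into \<open>C\<close>, while \<open>X\<close> generates
  \<open>C\<close> and is fixed.\<close>

lemma exists_retraction:
  assumes "independence_algebra A F" "subalgebra A F C" "C \<noteq> {}"
  obtains \<epsilon> where "\<epsilon> \<in> endos_into A F C" "\<And>x. x \<in> C \<Longrightarrow> \<epsilon> x = x"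
proof -
  have A: "closed_under F A" "exchange_property A F" "free_basis_property A F"
    using assms(1) by (auto simp: independence_algebra_def is_algebra_def)
  have C: "C \<subseteq> A" "closed_under F C" using assms(2) by (auto simp: subalgebra_def)
  have "independent F {}" by (simp add: independent_def)
  then obtain X where X: "basis_of F C X"
    using independent_extends_to_basis[OF A(2) C, of "{}"] by auto
  then obtain Z where Z: "X \<subseteq> Z" "basis_of F A Z"
    using independent_extends_to_basis[OF A(2) subset_refl A(1), of X] C
    unfolding basis_of_def by blast
  \<comment> \<open>The common value for \<open>Z - X\<close>. If \<open>C\<close> is generated by
    constants, then \<open>X\<close> is empty and all of \<open>Z\<close> goes to
    \<open>c\<close>.\<close>
  obtain c where c: "c \<in> C" using assms(3) by auto
  define g where "g = (\<lambda>x. if x \<in> X then x else c)"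
  have gC: "g x \<in> C" for x using X c by (auto simp: g_def basis_of_def)
  then have "g \<in> Z \<rightarrow> A" using C by auto
  then obtain \<epsilon> where \<epsilon>: "\<epsilon> \<in> endomorphisms A F" "\<And>z. z \<in> Z \<Longrightarrow> \<epsilon> z = g z"
    using A(3) Z(2) unfolding free_basis_property_def by meson
  have ZA: "Z \<subseteq> A" "gen F Z = A" and XC: "X \<subseteq> C" "gen F X = C"
    using Z X by (auto simp: basis_of_def)
  have "\<epsilon> ` Z \<subseteq> C" using \<epsilon>(2) gC by auto
  then have "\<epsilon> ` A \<subseteq> C" using endomorphism_image_gen[OF \<epsilon>(1) A(1) ZA(1) C(2)] ZA by simp
  then have "\<epsilon> \<in> endos_into A F C" using \<epsilon>(1) by (simp add: endos_into_def)
  moreover have "\<epsilon> x = x" if "x \<in> X" for x using that \<epsilon>(2) Z(1) by (auto simp: g_def)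
  then have "\<epsilon> x = x" if "x \<in> C" for x
    using endomorphism_fixes_gen[OF \<epsilon>(1) A(1)] XC C that by blast
  ultimately show ?thesis using that by blast
qed

section \<open>Right multiplication and the two relations\<close>

lemma rcomp_eq_iff:
  "rcomp A \<alpha> x = rcomp A \<alpha> y \<longleftrightarrow> (\<forall>c \<in> \<alpha> ` A. x c = y c)"
  by (auto simp: rcomp_def compose_def fun_eq_iff)

text \<open>Outside \<open>A\<close> both sides are \<open>undefined\<close>, because
  \<open>\<alpha>\<close> is extensional; only the points of the image remain to be
  compared.\<close>

lemma rcomp_eq_self_iff:
  assumes "\<alpha> \<in> endomorphisms A F"
  shows "rcomp A \<alpha> x = \<alpha> \<longleftrightarrow> (\<forall>c \<in> \<alpha> ` A. x c = c)"
  using assms by (auto simp: rcomp_def compose_def fun_eq_iff endomorphisms_def PiE_def extensional_def)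

text \<open>Although \<open>id\<close> need not be extensional on \<open>A\<close>, it may stand for
  the adjoined identity as a right factor, since composition restricts to \<open>A\<close>.
  Equations over the monoid thus all fall under \<open>rcomp_eq_iff\<close>.\<close>

lemma mult_one_rcomp:
  assumes "\<alpha> \<in> endomorphisms A F"
  shows "mult_one (rcomp A) \<alpha> x = rcomp A \<alpha> (case x of None \<Rightarrow> id | Some f \<Rightarrow> f)"
proof (cases x)
  case None
  have "rcomp A \<alpha> id = \<alpha>" unfolding rcomp_eq_self_iff[OF assms] by simp
  then show ?thesis using None by simp
qed simp

text \<open>The equation \<open>m a f = a\<close> is the instance of the defining condition in which
  the second factor is an identity.\<close>

lemma L_star_subset_L_tilde: "L_star S m \<subseteq> L_tilde S m"
proof clarify
  fix a b assume ab: "(a, b) \<in> L_star S m"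
  then have S: "a \<in> S" "b \<in> S" by (auto simp: L_star_def)
  \<comment> \<open>\<open>None\<close> is adjoined only if \<open>S\<close> lacks an identity, so
    \<open>e\<close> is either \<open>None\<close> or the identity of \<open>S\<close>
    itself.\<close>
  obtain e where e: "e \<in> adjoin_one S m" "mult_one m a e = a" "mult_one m b e = b"
  proof (cases "has_identity S m")
    case True
    then obtain i where "i \<in> S" "\<forall>x \<in> S. m i x = x \<and> m x i = x"
      by (auto simp: has_identity_def)
    then show ?thesis using that[of "Some i"] S True by (auto simp: adjoin_one_def)
  next
    case False
    then show ?thesis using that[of None] by (auto simp: adjoin_one_def)
  qed
  have "m a f = a \<longleftrightarrow> m b f = b" if "f \<in> S" for f
  proof -
    have "Some f \<in> adjoin_one S m" using that by (auto simp: adjoin_one_def)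
    then have "mult_one m a (Some f) = mult_one m a e \<longleftrightarrow> mult_one m b (Some f) = mult_one m b e"
      using ab e(1) unfolding L_star_def by blast
    then show ?thesis using e by simp
  qed
  then show "(a, b) \<in> L_tilde S m" using S by (auto simp: L_tilde_def idempotents_def)
qed

lemma L_tilde_image_subset:
  assumes "independence_algebra A F" "subalgebra A F B"
    and "(\<alpha>, \<beta>) \<in> L_tilde (endos_into A F B) (rcomp A)"
  shows "\<beta> ` A \<subseteq> \<alpha> ` A"
proof -
  have A: "A \<noteq> {}" "closed_under F A"
    using assms(1) by (auto simp: independence_algebra_def is_algebra_def)
  have \<alpha>: "\<alpha> \<in> endomorphisms A F" "\<alpha> ` A \<subseteq> B" and \<beta>: "\<beta> \<in> endomorphisms A F"
    using assms(3) by (auto simp: L_tilde_def endos_into_def)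
  have BA: "B \<subseteq> A" using assms(2) by (simp add: subalgebra_def)
  have sub: "subalgebra A F (\<alpha> ` A)"
    using closed_under_endomorphism_image[OF \<alpha>(1) A(2)] \<alpha>(2) BA by (auto simp: subalgebra_def)
  obtain \<epsilon> where \<epsilon>: "\<epsilon> \<in> endos_into A F (\<alpha> ` A)" "\<And>x. x \<in> \<alpha> ` A \<Longrightarrow> \<epsilon> x = x"
    using exists_retraction[OF assms(1) sub] A(1) by blast
  then have im: "\<epsilon> \<in> endomorphisms A F" "\<epsilon> ` A \<subseteq> \<alpha> ` A" by (auto simp: endos_into_def)
  \<comment> \<open>A map that fixes every point of its own image is idempotent.\<close>
  have "rcomp A \<epsilon> \<epsilon> = \<epsilon>" using rcomp_eq_self_iff[OF im(1)] im(2) \<epsilon>(2) by blast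
  then have "\<epsilon> \<in> idempotents (endos_into A F B) (rcomp A)"
    using im \<alpha>(2) by (auto simp: idempotents_def endos_into_def)
  then have "rcomp A \<alpha> \<epsilon> = \<alpha> \<longleftrightarrow> rcomp A \<beta> \<epsilon> = \<beta>" using assms(3) by (auto simp: L_tilde_def)
  \<comment> \<open>The left side of the equivalence holds because \<open>\<epsilon>\<close> fixes
    the image of \<open>\<alpha>\<close>; the right side then says that it fixes the image of
    \<open>\<beta>\<close>.\<close>
  then have fixed: "\<forall>c \<in> \<beta> ` A. \<epsilon> c = c"
    using \<epsilon>(2) rcomp_eq_self_iff[OF \<alpha>(1)] rcomp_eq_self_iff[OF \<beta>] by blast
  show ?thesis
  proof
    fix c assume c: "c \<in> \<beta> ` A"
    then have "c \<in> A" using \<beta> by (auto simp: endomorphisms_def)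
    then have "\<epsilon> c \<in> \<alpha> ` A" using im(2) by blast
    then show "c \<in> \<alpha> ` A" using fixed c by simp
  qed
qed

text \<open>Each of the two equations says that the right factors agree on the common image.\<close>

lemma L_star_if_image_eq:
  assumes "\<alpha> \<in> endos_into A F B" "\<beta> \<in> endos_into A F B" "\<alpha> ` A = \<beta> ` A"
  shows "(\<alpha>, \<beta>) \<in> L_star (endos_into A F B) (rcomp A)"
proof -
  have e: "\<alpha> \<in> endomorphisms A F" "\<beta> \<in> endomorphisms A F"
    using assms by (auto simp: endos_into_def)
  show ?thesis
    using assms unfolding L_star_def
    by (simp add: mult_one_rcomp[OF e(1)] mult_one_rcomp[OF e(2)] rcomp_eq_iff del: mult_one.simps)
qed

theorem proposition6p2:
  fixes A B :: "'a set" and F :: "'a operations"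
  assumes "independence_algebra A F"
    and "subalgebra A F B" and "B \<noteq> {}" and "B \<noteq> A"
    and "BNF_Cardinal_Arithmetic.ctwo \<le>o alg_dim F B \<or>
         (gen F {} \<noteq> {} \<and> alg_dim F B =o BNF_Cardinal_Arithmetic.cone)"
  shows "(\<forall>\<alpha> \<in> endos_into A F B. \<forall>\<beta> \<in> endos_into A F B.
            (\<alpha>, \<beta>) \<in> L_tilde (endos_into A F B) (rcomp A) \<longleftrightarrow> \<alpha> ` A = \<beta> ` A)
         \<and> L_star (endos_into A F B) (rcomp A) = L_tilde (endos_into A F B) (rcomp A)"
proof -
  let ?S = "endos_into A F B"
  have image_eq: "\<alpha> ` A = \<beta> ` A" if "(\<alpha>, \<beta>) \<in> L_tilde ?S (rcomp A)" for \<alpha> \<beta>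
  proof -
    \<comment> \<open>By symmetry the one-sided inclusion of images applies in both
      directions.\<close>
    have "(\<beta>, \<alpha>) \<in> L_tilde ?S (rcomp A)" using that by (auto simp: L_tilde_def)
    then show ?thesis using that L_tilde_image_subset[OF assms(1,2)] by blast
  qed
  have iff: "(\<alpha>, \<beta>) \<in> L_tilde ?S (rcomp A) \<longleftrightarrow> \<alpha> ` A = \<beta> ` A"
    if "\<alpha> \<in> ?S" "\<beta> \<in> ?S" for \<alpha> \<beta>
    \<comment> \<open>Equal images give \<open>L_star\<close>, which implies \<open>L_tilde\<close>,
      which gives back equal images.\<close>
    using image_eq L_star_if_image_eq[OF that] subsetD[OF L_star_subset_L_tilde] by fast
  have "L_tilde ?S (rcomp A) \<subseteq> L_star ?S (rcomp A)"
  proof clarify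
    fix \<alpha> \<beta> assume "(\<alpha>, \<beta>) \<in> L_tilde ?S (rcomp A)"
    moreover from this have "\<alpha> \<in> ?S" "\<beta> \<in> ?S" by (auto simp: L_tilde_def)
    ultimately show "(\<alpha>, \<beta>) \<in> L_star ?S (rcomp A)"
      using L_star_if_image_eq image_eq by metis
  qed
  then show ?thesis using iff L_star_subset_L_tilde by (intro conjI ballI equalityI)
qed

end
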